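(* Let $T_4^{(2)}(x,y):=\sum_{n\ge 1}x^n\sum_{T\in\mathcal{T}^{(2)}(K_4\times P_n)}y^{\rho(T)}$. Then $$T_4^{(2)}(x,y)=\frac{2xy\left(1+7y-x(y-1)\left(7y^2+y-9\right)+x^2(y-1)^2\left(8y^2-17y+8\right)\right)}{1-2x(y^2+2y+5)+x^2(y-1)(y^3+6y^2+8y-17)-x^3(y-1)^2(y^3+6y^2-17y+8)}.$$
   Context: $K_m$ is the complete graph on $m$ vertices and $P_n$ the path graph on $n$ vertices. The product $G_1\times G_2$ of graphs $G_1=(V_1,E_1)$, $G_2=(V_2,E_2)$ is the Cartesian product: its vertex set is $V_1\times V_2$, and $(v_1,v_2),(w_1,w_2)$ are adjacent iff ($v_1=w_1$ and $\{v_2,w_2\}\in E_2$) or ($v_2=w_2$ and $\{v_1,w_1\}\in E_1$). For a finite undirected graph $G=(V,E)$, two nonempty disjoint subsets $V_1,V_2\subseteq V$ are neighbors if there is an edge of $G$ with one endpoint in $V_1$ and the other in $V_2$. A $k$-colored partition of $G$ is a partition $V=\bigcup_{i=1}^s V_i$ together with an assignment of one of $k$ colors to each $V_i$ (all vertices of $V_i$ get that color), such that each $V_i$ induces a connected subgraph of $G$ and any two neighboring sets $V_i,V_j$ have different colors. The sets $V_i$ are the blocks, and the size $\rho(T)$ of a $k$-colored partition $T$ is its number of blocks. $\mathcal{T}^{(k)}(G)$ denotes the set of all $k$-colored partitions of $G$. Generating functions are formal power series in $x$ with coefficients polynomial in $y$. *)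

theory Defs
  imports Main "HOL-Library.Disjoint_Sets" "HOL-Library.FuncSet"
    "HOL-Computational_Algebra.Computational_Algebra"
begin

record 'a ugraph =
  verts :: "'a set"
  edges :: "'a set set"

definition finite_ugraph :: "'a ugraph \<Rightarrow> bool" where
  "finite_ugraph G \<longleftrightarrow> finite (verts G) \<and> (\<forall>e\<in>edges G. e \<subseteq> verts G \<and> card e = 2)"

definition complete_graph :: "nat \<Rightarrow> nat ugraph" where
  "complete_graph m = \<lparr>verts = {..<m}, edges = {{i, j} | i j. i < m \<and> j < m \<and> i \<noteq> j}\<rparr>"

definition path_graph :: "nat \<Rightarrow> nat ugraph" where
  "path_graph n = \<lparr>verts = {..<n}, edges = {{i, Suc i} | i. Suc i < n}\<rparr>"

definition cartesian_product :: "'a ugraph \<Rightarrow> 'b ugraph \<Rightarrow> ('a \<times> 'b) ugraph" where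
  "cartesian_product G H =
     \<lparr>verts = verts G \<times> verts H,
      edges = {{(v1, v2), (w1, w2)} | v1 v2 w1 w2.
        v1 \<in> verts G \<and> w1 \<in> verts G \<and> v2 \<in> verts H \<and> w2 \<in> verts H \<and>
        ((v1 = w1 \<and> {v2, w2} \<in> edges H) \<or> (v2 = w2 \<and> {v1, w1} \<in> edges G))}\<rparr>"

definition induced_subgraph :: "'a ugraph \<Rightarrow> 'a set \<Rightarrow> 'a ugraph" where
  "induced_subgraph G S = \<lparr>verts = S, edges = {e \<in> edges G. e \<subseteq> S}\<rparr>"

definition connected_graph :: "'a ugraph \<Rightarrow> bool" where
  "connected_graph G \<longleftrightarrow> verts G \<noteq> {} \<and>
     (\<forall>u\<in>verts G. \<forall>v\<in>verts G. (u, v) \<in> {(a, b). {a, b} \<in> edges G}\<^sup>*)"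

definition neighbors :: "'a ugraph \<Rightarrow> 'a set \<Rightarrow> 'a set \<Rightarrow> bool" where
  "neighbors G A B \<longleftrightarrow> A \<noteq> {} \<and> B \<noteq> {} \<and> A \<inter> B = {} \<and> (\<exists>a\<in>A. \<exists>b\<in>B. {a, b} \<in> edges G)"

text \<open>
  A colored partition is the set of its blocks together with a map from the blocks to the
  colors \<open>1, \<dots>, k\<close>.  The color map is extensional (\<open>undefined\<close> off the
  blocks), so that different values outside the blocks are not counted separately.
\<close>

definition colored_partitions :: "nat \<Rightarrow> 'a ugraph \<Rightarrow> ('a set set \<times> ('a set \<Rightarrow> nat)) set" where
  "colored_partitions k G =
     {(P, c). partition_on (verts G) P \<and> c \<in> P \<rightarrow>\<^sub>E {1..k} \<and>
        (\<forall>A\<in>P. connected_graph (induced_subgraph G A)) \<and>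
        (\<forall>A\<in>P. \<forall>B\<in>P. neighbors G A B \<longrightarrow> c A \<noteq> c B)}"

definition partition_size :: "'a set set \<times> ('a set \<Rightarrow> nat) \<Rightarrow> nat" where
  "partition_size T = card (fst T)"

text \<open>
  Power series in \<open>x\<close> (the outer \<open>fps\<close>) whose coefficients are
  polynomials in \<open>y\<close> (the inner \<open>poly\<close>).
\<close>

definition colored_partition_gf :: "nat \<Rightarrow> nat \<Rightarrow> int poly fps" where
  "colored_partition_gf k m = Abs_fps (\<lambda>n. if n = 0 then 0 else
     (\<Sum>T\<in>colored_partitions k (cartesian_product (complete_graph m) (path_graph n)).
        monom 1 (partition_size T)))"

abbreviation gf_x :: "int poly fps" where
  "gf_x \<equiv> fps_X"

abbreviation gf_y :: "int poly fps" where
  "gf_y \<equiv> fps_const (monom 1 1)"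

text \<open>
  The library's division of power series needs a field of coefficients.  Over a commutative
  ring this is the quotient by a power series with constant coefficient 1; it is
  meaningless for other denominators.
\<close>

definition fps_quotient :: "'a::comm_ring_1 fps \<Rightarrow> 'a fps \<Rightarrow> 'a fps" where
  "fps_quotient f g = f * fps_right_inverse g 1"

lemma fps_quotient_eq_iff:
  assumes "fps_nth g 0 = (1::'a::comm_ring_1)"
  shows "h = fps_quotient f g \<longleftrightarrow> h * g = f"
proof -
  have inv: "g * fps_right_inverse g 1 = 1"
    by (rule fps_right_inverse) (simp add: assms)
  show ?thesis
  proof
    assume "h = fps_quotient f g"
    then have "h * g = f * (g * fps_right_inverse g 1)"
      by (simp add: fps_quotient_def mult_ac)
    then show "h * g = f" by (simp add: inv)
  next
    assume "h * g = f"
    then have "fps_quotient f g = h * (g * fps_right_inverse g 1)"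
      by (metis fps_quotient_def mult.assoc)
    then show "h = fps_quotient f g" by (simp add: inv)
  qed
qed

lemma finite_colored_partitions:
  assumes "finite (verts G)"
  shows "finite (colored_partitions k G)"
proof (rule finite_subset)
  show "colored_partitions k G \<subseteq>
      (SIGMA P:{P. partition_on (verts G) P}. P \<rightarrow>\<^sub>E {1..k})"
    by (auto simp: colored_partitions_def)
  show "finite (SIGMA P:{P. partition_on (verts G) P}. P \<rightarrow>\<^sub>E {1..k})"
    using assms by (auto intro!: finite_SigmaI finitely_many_partition_on finite_PiE
        intro: finite_elements)
qed

lemma finite_ugraph_complete_graph: "finite_ugraph (complete_graph m)"
  by (auto simp: finite_ugraph_def complete_graph_def)

lemma finite_ugraph_path_graph: "finite_ugraph (path_graph n)"
  by (auto simp: finite_ugraph_def path_graph_def)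

lemma edge_neq: "finite_ugraph G \<Longrightarrow> {a, b} \<in> edges G \<Longrightarrow> a \<noteq> b"
  by (auto simp: finite_ugraph_def)

lemma finite_ugraph_cartesian_product:
  assumes "finite_ugraph G" "finite_ugraph H"
  shows "finite_ugraph (cartesian_product G H)"
proof -
  have "e \<subseteq> verts G \<times> verts H \<and> card e = 2"
    if "e \<in> edges (cartesian_product G H)" for e
  proof -
    obtain v1 v2 w1 w2 where e: "e = {(v1, v2), (w1, w2)}"
      and v: "v1 \<in> verts G" "w1 \<in> verts G" "v2 \<in> verts H" "w2 \<in> verts H"
      and d: "(v1 = w1 \<and> {v2, w2} \<in> edges H) \<or> (v2 = w2 \<and> {v1, w1} \<in> edges G)"
      using \<open>e \<in> _\<close> unfolding cartesian_product_def by auto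
    have "(v1, v2) \<noteq> (w1, w2)"
      using d edge_neq[OF assms(1)] edge_neq[OF assms(2)] by auto
    then show ?thesis using e v by (simp add: card_2_iff)
  qed
  then show ?thesis
    using assms by (simp add: finite_ugraph_def cartesian_product_def)
qed

end

theory Submission
  imports Defs
begin

text \<open>
  The blocks of a colored partition are the monochromatic components of the induced vertex coloring,
  so colored partitions correspond to arbitrary colorings.  In \<open>K_m \<times> P_n\<close> every color
  class of a column \<open>K_m\<close> is connected; hence a component is determined by its color and its
  first column, and the number of components is a sum of contributions of consecutive columns.
  For \<open>m = 4\<close> and two colors the resulting transfer matrix on 16 columns collapses to three
  column types, and its \<open>3 \<times> 3\<close> linear system is solved by Cramer's rule.
\<close>

section \<open>Colored partitions as vertex colorings\<close>

definition mono_step :: "'a ugraph \<Rightarrow> ('a \<Rightarrow> 'c) \<Rightarrow> ('a \<times> 'a) set" where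
  "mono_step G f = {(a, b). {a, b} \<in> edges G \<and> f a = f b}"

text \<open>The closure \<open>\<^sup>*\<close> is reflexive on the whole type, so both endpoints
  are restricted to the vertex set to get an equivalence on it.\<close>

definition mono_equiv :: "'a ugraph \<Rightarrow> ('a \<Rightarrow> 'c) \<Rightarrow> ('a \<times> 'a) set" where
  "mono_equiv G f = {(a, b). a \<in> verts G \<and> b \<in> verts G \<and> (a, b) \<in> (mono_step G f)\<^sup>*}"

lemma mono_step_rtrancl_color: "(a, b) \<in> (mono_step G f)\<^sup>* \<Longrightarrow> f a = f b"
  by (induction rule: rtrancl_induct) (auto simp: mono_step_def)

lemma sym_mono_step_rtrancl: "sym ((mono_step G f)\<^sup>*)"
  by (rule sym_rtrancl) (auto simp: mono_step_def sym_def insert_commute)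

lemma equiv_mono_equiv: "equiv (verts G) (mono_equiv G f)"
proof (rule equivI)
  show "sym (mono_equiv G f)"
    using sym_mono_step_rtrancl[of G f] by (auto simp: mono_equiv_def sym_def)
  show "trans (mono_equiv G f)"
    by (auto simp: mono_equiv_def trans_def)
qed (auto simp: mono_equiv_def refl_on_def)

lemma edge_in_verts:
  assumes "finite_ugraph G" "{a, b} \<in> edges G"
  shows "a \<in> verts G" "b \<in> verts G"
  using assms by (auto simp: finite_ugraph_def)

text \<open>A monochromatic path cannot leave a block, because neighboring blocks differ in color;
  conversely a block is connected and has one color. So the blocks can be recovered from the
  coloring alone, which gives injectivity of the passage to colorings.\<close>

lemma colored_partition_blocks:
  assumes G: "finite_ugraph G" and T: "(P, c) \<in> colored_partitions k G"
    and f: "\<And>A v. A \<in> P \<Longrightarrow> v \<in> A \<Longrightarrow> f v = c A"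
  shows "verts G // mono_equiv G f = P"
proof -
  have P: "partition_on (verts G) P"
    and conn: "\<And>A. A \<in> P \<Longrightarrow> connected_graph (induced_subgraph G A)"
    and col: "\<And>A B. A \<in> P \<Longrightarrow> B \<in> P \<Longrightarrow> neighbors G A B \<Longrightarrow> c A \<noteq> c B"
    using T by (auto simp: colored_partitions_def)
  have "mono_equiv G f = {(a, b). \<exists>A\<in>P. a \<in> A \<and> b \<in> A}"
  proof (intro equalityI subrelI)
    fix a b assume ab: "(a, b) \<in> mono_equiv G f"
    then obtain A where A: "A \<in> P" "a \<in> A"
      using P by (auto simp: mono_equiv_def partition_on_def)
    have "(a, b) \<in> (mono_step G f)\<^sup>*"
      using ab by (simp add: mono_equiv_def)
    then have "b \<in> A"
    proof (induction rule: rtrancl_induct)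
      case (step u v)
      then have uv: "{u, v} \<in> edges G" "f u = f v"
        by (auto simp: mono_step_def)
      obtain B where B: "B \<in> P" "v \<in> B"
        using edge_in_verts(2)[OF G uv(1)] P by (auto simp: partition_on_def)
      \<comment> \<open>Blocks of equal color are not neighbors. Since an edge joins them,
        disjointness is the only condition of \<open>neighbors\<close> that can fail, so they meet
        and therefore coincide.\<close>
      have "\<not> neighbors G A B"
        using col[OF A(1) B(1)] f[OF A(1) step.IH] f[OF B] uv(2) by auto
      then have "A \<inter> B \<noteq> {}"
        using step.IH B(2) uv(1) by (auto simp: neighbors_def)
      then have "A = B"
        using partition_onD2[OF P] A(1) B(1) by (auto dest: disjointD)
      then show ?case using B(2) by simp
    qed (use A in auto)
    then show "(a, b) \<in> {(a, b). \<exists>A\<in>P. a \<in> A \<and> b \<in> A}"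
      using A by auto
  next
    fix a b assume "(a, b) \<in> {(a, b). \<exists>A\<in>P. a \<in> A \<and> b \<in> A}"
    then obtain A where A: "A \<in> P" "a \<in> A" "b \<in> A" by auto
    have "(a, b) \<in> {(u, v). {u, v} \<in> edges (induced_subgraph G A)}\<^sup>*"
      using conn[OF A(1)] A(2,3) by (auto simp: connected_graph_def induced_subgraph_def)
    moreover have "{(u, v). {u, v} \<in> edges (induced_subgraph G A)} \<subseteq> mono_step G f"
      using f[OF A(1)] by (auto simp: mono_step_def induced_subgraph_def)
    ultimately have "(a, b) \<in> (mono_step G f)\<^sup>*"
      using rtrancl_mono by blast
    then show "(a, b) \<in> mono_equiv G f"
      using A P by (auto simp: mono_equiv_def partition_on_def)
  qed
  then show ?thesis
    using partition_on_eq_quotient[OF P] by simp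
qed

text \<open>The color is read off at an arbitrary representative, as it is constant on each class.
  The restricted abstraction makes the color map extensional, as \<open>colored_partitions\<close>
  demands.\<close>

definition coloring_partition :: "'a ugraph \<Rightarrow> ('a \<Rightarrow> 'c) \<Rightarrow> 'a set set \<times> ('a set \<Rightarrow> 'c)" where
  "coloring_partition G f =
     (verts G // mono_equiv G f, \<lambda>A \<in> verts G // mono_equiv G f. f (SOME a. a \<in> A))"

lemma mono_class_color:
  assumes "A \<in> verts G // mono_equiv G f" "a \<in> A"
  shows "f (SOME a. a \<in> A) = f a"
proof -
  have "(SOME a. a \<in> A) \<in> A" using assms(2) by (rule someI)
  then have "((SOME a. a \<in> A), a) \<in> mono_equiv G f"
    using quotient_eq_iff[OF equiv_mono_equiv assms(1) assms(1)] assms(2) by auto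
  then show ?thesis
    by (auto simp: mono_equiv_def dest: mono_step_rtrancl_color)
qed

text \<open>A monochromatic path stays inside its class, so classes are connected; an edge between
  two classes of the same color would be monochromatic and would merge them.\<close>

lemma coloring_partition_in_colored_partitions:
  assumes G: "finite_ugraph G" and f: "f \<in> verts G \<rightarrow>\<^sub>E {1..k}"
  shows "coloring_partition G f \<in> colored_partitions k G"
proof -
  let ?P = "verts G // mono_equiv G f"
  let ?c = "\<lambda>A \<in> ?P. f (SOME a. a \<in> A)"
  have P: "partition_on (verts G) ?P"
    by (rule partition_on_quotient[OF equiv_mono_equiv])
  have col: "?c A = f a" if "A \<in> ?P" "a \<in> A" for A a
    using mono_class_color[OF that] that(1) by simp
  have sub: "A \<subseteq> verts G" "A \<noteq> {}" if "A \<in> ?P" for A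
    using P that by (auto simp: partition_on_def)
  have "?c \<in> ?P \<rightarrow>\<^sub>E {1..k}"
  proof (rule PiE_I)
    fix A assume A: "A \<in> ?P"
    then obtain a where "a \<in> A" using sub by blast
    then show "?c A \<in> {1..k}"
      using col[OF A] sub(1)[OF A] f by (metis PiE_mem subsetD)
  qed auto
  moreover have "connected_graph (induced_subgraph G A)" if A: "A \<in> ?P" for A
  proof -
    have "(a, b) \<in> {(u, v). {u, v} \<in> edges (induced_subgraph G A)}\<^sup>*" if ab: "a \<in> A" "b \<in> A" for a b
    proof -
      have "(a, b) \<in> (mono_step G f)\<^sup>*"
        using quotient_eq_iff[OF equiv_mono_equiv A A ab] by (simp add: mono_equiv_def)
      \<comment> \<open>Membership in \<open>A\<close> is carried through the induction, so that
        each edge of the path is seen to lie in the induced subgraph.\<close>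
      then have "b \<in> A \<and> (a, b) \<in> {(u, v). {u, v} \<in> edges (induced_subgraph G A)}\<^sup>*"
      proof (induction rule: rtrancl_induct)
        case (step u v)
        have "{u, v} \<in> edges G" using step by (simp add: mono_step_def)
        then have "(u, v) \<in> mono_equiv G f"
          using step edge_in_verts[OF G] by (auto simp: mono_equiv_def)
        then have "v \<in> A"
          using in_quotient_imp_closed[OF equiv_mono_equiv A] step by blast
        then have "(u, v) \<in> {(u, v). {u, v} \<in> edges (induced_subgraph G A)}"
          using step \<open>{u, v} \<in> edges G\<close> by (auto simp: induced_subgraph_def)
        then show ?case
          using step \<open>v \<in> A\<close> by (meson rtrancl.rtrancl_into_rtrancl)
      qed (use ab in auto)
      then show ?thesis by simp
    qed
    then show ?thesis
      using sub(2)[OF A] by (auto simp: connected_graph_def induced_subgraph_def)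
  qed
  moreover have "?c A \<noteq> ?c B" if A: "A \<in> ?P" and B: "B \<in> ?P" and AB: "neighbors G A B" for A B
  proof
    assume eq: "?c A = ?c B"
    obtain a b where ab: "a \<in> A" "b \<in> B" "{a, b} \<in> edges G" "A \<inter> B = {}"
      using AB by (auto simp: neighbors_def)
    then have "(a, b) \<in> mono_step G f"
      using eq col[OF A ab(1)] col[OF B ab(2)] by (simp add: mono_step_def)
    then have "(a, b) \<in> mono_equiv G f"
      using edge_in_verts[OF G ab(3)] by (auto simp: mono_equiv_def)
    then have "b \<in> A"
      using in_quotient_imp_closed[OF equiv_mono_equiv A ab(1)] by blast
    then show False using ab by blast
  qed
  ultimately show ?thesis
    using P by (simp add: coloring_partition_def colored_partitions_def)
qed

text \<open>The inverse of \<open>coloring_partition\<close>. The description \<open>THE\<close> is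
  meaningful because a vertex lies in exactly one block.\<close>

definition partition_coloring :: "'a ugraph \<Rightarrow> 'a set set \<times> ('a set \<Rightarrow> 'c) \<Rightarrow> 'a \<Rightarrow> 'c" where
  "partition_coloring G T = (\<lambda>v \<in> verts G. snd T (THE A. A \<in> fst T \<and> v \<in> A))"

lemma partition_coloring_eq:
  assumes P: "partition_on (verts G) P" and A: "A \<in> P" "v \<in> A"
  shows "partition_coloring G (P, c) v = c A"
proof -
  have "(THE B. B \<in> P \<and> v \<in> B) = A"
    using partition_onD2[OF P] A by (intro the_equality) (auto dest: disjointD)
  moreover have "v \<in> verts G"
    using P A by (auto simp: partition_on_def)
  ultimately show ?thesis by (simp add: partition_coloring_def)
qed

lemma bij_betw_coloring_partition:
  assumes G: "finite_ugraph G"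
  shows "bij_betw (coloring_partition G) (verts G \<rightarrow>\<^sub>E {1..k}) (colored_partitions k G)"
proof (rule bij_betw_byWitness[where f' = "partition_coloring G"])
  show "\<forall>f\<in>verts G \<rightarrow>\<^sub>E {1..k}. partition_coloring G (coloring_partition G f) = f"
  proof
    fix f assume f: "f \<in> verts G \<rightarrow>\<^sub>E {1..k}"
    show "partition_coloring G (coloring_partition G f) = f"
    proof
      fix v show "partition_coloring G (coloring_partition G f) v = f v"
      proof (cases "v \<in> verts G")
        case True
        then obtain A where A: "A \<in> verts G // mono_equiv G f" "v \<in> A"
          by (metis equiv_class_self equiv_mono_equiv quotientI)
        show ?thesis
          unfolding coloring_partition_def
          by (subst partition_coloring_eq[OF partition_on_quotient[OF equiv_mono_equiv] A])
            (simp add: mono_class_color[OF A] A(1))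
      next
        case False
        then show ?thesis
          using f by (auto simp: partition_coloring_def PiE_def extensional_def)
      qed
    qed
  qed
  have *: "partition_coloring G T \<in> verts G \<rightarrow>\<^sub>E {1..k} \<and>
      coloring_partition G (partition_coloring G T) = T" if "T \<in> colored_partitions k G" for T
  proof -
    obtain P c where T: "T = (P, c)" by (cases T)
    let ?f = "partition_coloring G (P, c)"
    have Pc: "(P, c) \<in> colored_partitions k G" and P: "partition_on (verts G) P"
      and c: "c \<in> P \<rightarrow>\<^sub>E {1..k}"
      using that T by (auto simp: colored_partitions_def)
    note f = partition_coloring_eq[OF P, where c = c]
    have blocks: "verts G // mono_equiv G ?f = P"
      by (rule colored_partition_blocks[OF G Pc f])
    have "?f \<in> verts G \<rightarrow>\<^sub>E {1..k}"
    proof (rule PiE_I)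
      fix v assume "v \<in> verts G"
      then obtain A where "A \<in> P" "v \<in> A" using P by (auto simp: partition_on_def)
      then show "?f v \<in> {1..k}" using f c by auto
    qed (auto simp: partition_coloring_def)
    moreover have "(\<lambda>A\<in>P. ?f (SOME a. a \<in> A)) = c"
    proof
      fix A show "(\<lambda>A\<in>P. ?f (SOME a. a \<in> A)) A = c A"
      proof (cases "A \<in> P")
        case True
        then have "(SOME a. a \<in> A) \<in> A"
          using P by (metis partition_onD3 some_in_eq)
        then show ?thesis using True f by simp
      qed (use c in \<open>auto simp: PiE_def extensional_def\<close>)
    qed
    ultimately show ?thesis
      using blocks T by (simp add: coloring_partition_def)
  qed
  then show "\<forall>T\<in>colored_partitions k G. coloring_partition G (partition_coloring G T) = T"
    and "partition_coloring G ` colored_partitions k G \<subseteq> verts G \<rightarrow>\<^sub>E {1..k}"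
    by auto
  show "coloring_partition G ` (verts G \<rightarrow>\<^sub>E {1..k}) \<subseteq> colored_partitions k G"
    using coloring_partition_in_colored_partitions[OF G] by auto
qed

section \<open>Monochromatic components of complete graph times path\<close>

abbreviation prism_graph :: "nat \<Rightarrow> nat \<Rightarrow> (nat \<times> nat) ugraph" where
  "prism_graph m n \<equiv> cartesian_product (complete_graph m) (path_graph n)"

lemma verts_prism: "verts (prism_graph m n) = {..<m} \<times> {..<n}"
  by (simp add: cartesian_product_def complete_graph_def path_graph_def)

lemma edges_cartesian_product:
  "{(v, i), (w, j)} \<in> edges (cartesian_product G H) \<longleftrightarrow>
     v \<in> verts G \<and> w \<in> verts G \<and> i \<in> verts H \<and> j \<in> verts H \<and>
     (v = w \<and> {i, j} \<in> edges H \<or> i = j \<and> {v, w} \<in> edges G)" (is "?L \<longleftrightarrow> ?R")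
proof
  assume ?L
  then obtain v1 v2 w1 w2 where "{(v, i), (w, j)} = {(v1, v2), (w1, w2)}"
    and "v1 \<in> verts G" "w1 \<in> verts G" "v2 \<in> verts H" "w2 \<in> verts H"
      "v1 = w1 \<and> {v2, w2} \<in> edges H \<or> v2 = w2 \<and> {v1, w1} \<in> edges G"
    by (auto simp: cartesian_product_def)
  then show ?R by (auto simp: doubleton_eq_iff insert_commute)
next
  assume ?R
  then show ?L by (simp add: cartesian_product_def) blast
qed

lemma edges_prism:
  "{(v, i), (w, j)} \<in> edges (prism_graph m n) \<longleftrightarrow> v < m \<and> w < m \<and> i < n \<and> j < n \<and>
     (v = w \<and> (j = Suc i \<or> i = Suc j) \<or> i = j \<and> v \<noteq> w)"
proof -
  have "{i, j} \<in> edges (path_graph n) \<longleftrightarrow> i < n \<and> j < n \<and> (j = Suc i \<or> i = Suc j)"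
    by (auto simp: path_graph_def doubleton_eq_iff)
  moreover have "{v, w} \<in> edges (complete_graph m) \<longleftrightarrow> v < m \<and> w < m \<and> v \<noteq> w"
    by (auto simp: complete_graph_def doubleton_eq_iff)
  ultimately show ?thesis
    unfolding edges_cartesian_product
    by (auto simp: complete_graph_def[of m] path_graph_def[of n])
qed

lemma finite_ugraph_prism: "finite_ugraph (prism_graph m n)"
  by (intro finite_ugraph_cartesian_product finite_ugraph_complete_graph finite_ugraph_path_graph)

text \<open>Walks to the left as long as some row has color \<open>c\<close> in both adjacent
  columns. If \<open>c\<close> occurs in the column at the start, the result is the leftmost column
  that the component of color \<open>c\<close> there reaches by this walk.\<close>

primrec first_column :: "nat \<Rightarrow> (nat \<times> nat \<Rightarrow> 'c) \<Rightarrow> 'c \<Rightarrow> nat \<Rightarrow> nat" where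
  "first_column m f c 0 = 0"
| "first_column m f c (Suc j) =
     (if \<exists>v<m. f (v, j) = c \<and> f (v, Suc j) = c then first_column m f c j else Suc j)"

definition component_label :: "nat \<Rightarrow> (nat \<times> nat \<Rightarrow> 'c) \<Rightarrow> nat \<times> nat \<Rightarrow> nat \<times> 'c" where
  "component_label m f p = (first_column m f (f p) (snd p), f p)"

text \<open>The colors whose component in column \<open>i\<close> is not a continuation from the
  column before; in column 0 this is every color present.\<close>

definition starts :: "nat \<Rightarrow> (nat \<times> nat \<Rightarrow> 'c) \<Rightarrow> nat \<Rightarrow> 'c set" where
  "starts m f i = {c. (\<exists>v<m. f (v, i) = c) \<and>
     \<not> (\<exists>j. i = Suc j \<and> (\<exists>v<m. f (v, j) = c \<and> f (v, Suc j) = c))}"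

text \<open>Equal colors within a column are adjacent, since the column is complete. Hence one can
  first move to a row in which the color continues to the left, then step left, and recurse.\<close>

lemma first_column_reachable:
  assumes "v < m" "j < n" "f (v, j) = c"
  shows "first_column m f c j \<le> j \<and> c \<in> starts m f (first_column m f c j) \<and>
    (\<exists>w<m. f (w, first_column m f c j) = c \<and>
      ((v, j), (w, first_column m f c j)) \<in> (mono_step (prism_graph m n) f)\<^sup>*)"
  using assms
proof (induction j arbitrary: v)
  case 0
  then show ?case by (auto simp: starts_def)
next
  case (Suc j)
  show ?case
  proof (cases "\<exists>v<m. f (v, j) = c \<and> f (v, Suc j) = c")
    case True
    then obtain u where u: "u < m" "f (u, j) = c" "f (u, Suc j) = c" by blast
    have "((v, Suc j), (u, Suc j)) \<in> (mono_step (prism_graph m n) f)\<^sup>*"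
    proof (cases "u = v")
      case False
      then show ?thesis
        using u Suc.prems by (intro r_into_rtrancl) (simp add: mono_step_def edges_prism)
    qed simp
    moreover have "((u, Suc j), (u, j)) \<in> mono_step (prism_graph m n) f"
      using u Suc.prems by (simp add: mono_step_def edges_prism)
    ultimately have *: "((v, Suc j), (u, j)) \<in> (mono_step (prism_graph m n) f)\<^sup>*"
      by simp
    have eq: "first_column m f c (Suc j) = first_column m f c j"
      using True by simp
    show ?thesis
      unfolding eq using Suc.IH[OF u(1) _ u(2)] Suc.prems(2) *
      by (meson Suc_lessD le_SucI rtrancl_trans)
  next
    case False
    then show ?thesis using Suc.prems by (auto simp: starts_def)
  qed
qed

text \<open>The label is a complete invariant of a component: it is constant along monochromatic
  edges, and two vertices with the same label are both connected to vertices of one color in the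
  same column, which are equal or adjacent.\<close>

lemma mono_equiv_prism:
  "mono_equiv (prism_graph m n) f =
     {(p, q). p \<in> verts (prism_graph m n) \<and> q \<in> verts (prism_graph m n) \<and>
        component_label m f p = component_label m f q}"
proof (intro equalityI subrelI)
  fix p q assume pq: "(p, q) \<in> mono_equiv (prism_graph m n) f"
  \<comment> \<open>An edge along the path is itself the witness that makes
    \<open>first_column\<close> recurse to the previous column; an edge inside a column changes
    neither the column nor the color.\<close>
  have step: "component_label m f a = component_label m f b"
    if "(a, b) \<in> mono_step (prism_graph m n) f" for a b
  proof -
    obtain v i w j where ab: "a = (v, i)" "b = (w, j)" by (cases a, cases b)
    show ?thesis
      using that by (auto simp: ab mono_step_def edges_prism component_label_def)
  qed
  have "(p, q) \<in> (mono_step (prism_graph m n) f)\<^sup>*"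
    using pq by (simp add: mono_equiv_def)
  then have "component_label m f p = component_label m f q"
    by (induction rule: rtrancl_induct) (auto dest: step)
  then show "(p, q) \<in> {(p, q). p \<in> verts (prism_graph m n) \<and> q \<in> verts (prism_graph m n) \<and>
      component_label m f p = component_label m f q}"
    using pq by (simp add: mono_equiv_def)
next
  fix p q assume pq: "(p, q) \<in> {(p, q). p \<in> verts (prism_graph m n) \<and>
    q \<in> verts (prism_graph m n) \<and> component_label m f p = component_label m f q}"
  let ?R = "(mono_step (prism_graph m n) f)\<^sup>*"
  define r where "r = first_column m f (f p) (snd p)"
  have c: "f q = f p" and r': "first_column m f (f p) (snd q) = r"
    using pq by (auto simp: component_label_def r_def)
  have V: "fst p < m" "snd p < n" "fst q < m" "snd q < n"
    using pq by (auto simp: verts_prism)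
  obtain u where u: "u < m" "f (u, r) = f p" "(p, (u, r)) \<in> ?R" "r \<le> snd p"
    using first_column_reachable[of "fst p" m "snd p" n f "f p"] V by (auto simp: r_def)
  obtain w where w: "w < m" "f (w, r) = f p" "(q, (w, r)) \<in> ?R"
    using first_column_reachable[of "fst q" m "snd q" n f "f p"] V c r' by auto
  have "((u, r), (w, r)) \<in> ?R"
  proof (cases "u = w")
    case False
    then show ?thesis
      using u w V by (intro r_into_rtrancl) (simp add: mono_step_def edges_prism)
  qed simp
  moreover have "((w, r), q) \<in> ?R"
    using w(3) sym_mono_step_rtrancl by (metis symD)
  ultimately have "(p, q) \<in> ?R" using u(3) by (meson rtrancl_trans)
  then show "(p, q) \<in> mono_equiv (prism_graph m n) f"
    using pq by (simp add: mono_equiv_def)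
qed

lemma card_quotient_kernel:
  "card (A // {(x, y). x \<in> A \<and> y \<in> A \<and> h x = h y}) = card (h ` A)"
proof -
  have "A // {(x, y). x \<in> A \<and> y \<in> A \<and> h x = h y} = (\<lambda>b. {x \<in> A. h x = b}) ` h ` A"
    by (force simp: quotient_def)
  moreover have "inj_on (\<lambda>b. {x \<in> A. h x = b}) (h ` A)"
    by (auto simp: inj_on_def)
  ultimately show ?thesis by (simp add: card_image)
qed

lemma finite_starts: "finite (starts m f i)"
  by (rule finite_subset[of _ "(\<lambda>v. f (v, i)) ` {..<m}"]) (auto simp: starts_def)

text \<open>Labels of components are exactly the starting positions. This turns the global count of
  components into a sum of terms local to consecutive columns.\<close>

lemma component_label_image:
  "component_label m f ` verts (prism_graph m n) = (SIGMA i:{..<n}. starts m f i)"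
proof (intro equalityI subsetI)
  fix x assume "x \<in> component_label m f ` verts (prism_graph m n)"
  then obtain v j where vj: "v < m" "j < n" "x = component_label m f (v, j)"
    by (auto simp: verts_prism)
  then show "x \<in> (SIGMA i:{..<n}. starts m f i)"
    using first_column_reachable[of v m j n f "f (v, j)"] by (auto simp: component_label_def)
next
  fix x assume "x \<in> (SIGMA i:{..<n}. starts m f i)"
  then obtain i c where ic: "x = (i, c)" "i < n" "c \<in> starts m f i" by auto
  then obtain v where v: "v < m" "f (v, i) = c" by (auto simp: starts_def)
  \<comment> \<open>For a color that starts in column \<open>i\<close> the recursion of
    \<open>first_column\<close> stops at once.\<close>
  have "component_label m f (v, i) = (i, c)"
    using ic(3) v by (cases i) (auto simp: component_label_def starts_def)
  then show "x \<in> component_label m f ` verts (prism_graph m n)"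
    using ic v by (intro image_eqI[of _ _ "(v, i)"]) (auto simp: verts_prism)
qed

lemma partition_size_prism:
  "partition_size (coloring_partition (prism_graph m n) f) = (\<Sum>i<n. card (starts m f i))"
  by (simp add: partition_size_def coloring_partition_def mono_equiv_prism card_quotient_kernel
      component_label_image finite_starts)

section \<open>Two-colorings with four rows and the transfer between columns\<close>

abbreviation prism_colorings :: "nat \<Rightarrow> (nat \<times> nat \<Rightarrow> nat) set" where
  "prism_colorings n \<equiv> {..<4} \<times> {..<n} \<rightarrow>\<^sub>E {1..2}"

definition coloring_weight :: "nat \<Rightarrow> (nat \<times> nat \<Rightarrow> nat) \<Rightarrow> int poly" where
  "coloring_weight n f = monom 1 1 ^ (\<Sum>i<n. card (starts 4 f i))"

lemma colored_partition_gf_nth: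
  "fps_nth (colored_partition_gf 2 4) n =
     (if n = 0 then 0 else \<Sum>f\<in>prism_colorings n. coloring_weight n f)"
proof -
  have "(\<Sum>T\<in>colored_partitions 2 (prism_graph 4 n). monom (1::int) (partition_size T)) =
      (\<Sum>f\<in>prism_colorings n. monom 1 (partition_size (coloring_partition (prism_graph 4 n) f)))"
    using bij_betw_coloring_partition[OF finite_ugraph_prism[of 4 n], of 2]
    by (intro sum.reindex_bij_betw[symmetric]) (simp add: verts_prism)
  also have "\<dots> = (\<Sum>f\<in>prism_colorings n. coloring_weight n f)"
    by (simp add: coloring_weight_def partition_size_prism monom_power)
  finally show ?thesis by (simp add: colored_partition_gf_def)
qed

text \<open>One entry per row, with \<open>True\<close> for color 1 and \<open>False\<close> for
  color 2.\<close>

type_synonym column = "bool \<times> bool \<times> bool \<times> bool"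

fun append_column :: "nat \<Rightarrow> column \<Rightarrow> (nat \<times> nat \<Rightarrow> nat) \<Rightarrow> nat \<times> nat \<Rightarrow> nat" where
  "append_column n (a, b, c, d) f =
     f((0, n) := if a then 1 else 2, (1, n) := if b then 1 else 2,
       (2, n) := if c then 1 else 2, (3, n) := if d then 1 else 2)"

definition column_of :: "(nat \<times> nat \<Rightarrow> nat) \<Rightarrow> nat \<Rightarrow> column" where
  "column_of f i = (f (0, i) = 1, f (1, i) = 1, f (2, i) = 1, f (3, i) = 1)"

text \<open>The two summands belong to colors 1 and 2: the color occurs in the new column, and no
  row has it in both columns. For color 2 the negation is already distributed over the rows.\<close>

fun new_in_column :: "column \<Rightarrow> column \<Rightarrow> nat" where
  "new_in_column (a', b', c', d') (a, b, c, d) =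
     of_bool ((a \<or> b \<or> c \<or> d) \<and> \<not> (a' \<and> a \<or> b' \<and> b \<or> c' \<and> c \<or> d' \<and> d)) +
     of_bool (\<not> (a \<and> b \<and> c \<and> d) \<and> (a' \<or> a) \<and> (b' \<or> b) \<and> (c' \<or> c) \<and> (d' \<or> d))"

fun colors_in_column :: "column \<Rightarrow> nat" where
  "colors_in_column (a, b, c, d) = of_bool (a \<or> b \<or> c \<or> d) + of_bool (\<not> (a \<and> b \<and> c \<and> d))"

lemma ex_less_4: "(\<exists>v<4. P v) \<longleftrightarrow> P 0 \<or> P 1 \<or> P 2 \<or> P (3::nat)"
  by (simp add: numeral_eq_Suc less_Suc_eq ex_disj_distrib conj_disj_distribR disj_ac)

lemma prism_coloring_cases:
  assumes "f \<in> prism_colorings n" "i < n" "v < 4"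
  shows "f (v, i) = 1 \<or> f (v, i) = 2"
  using PiE_mem[OF assms(1), of "(v, i)"] assms(2,3) by auto

lemma card_starts:
  assumes "f \<in> prism_colorings n" "i < n"
  shows "card (starts 4 f i) = of_bool (1 \<in> starts 4 f i) + of_bool (2 \<in> starts 4 f i)"
proof -
  have "starts 4 f i \<subseteq> {1, 2}"
    using prism_coloring_cases[OF assms] by (auto simp: starts_def)
  then have "starts 4 f i = {c \<in> {1, 2}. c \<in> starts 4 f i}" by blast
  then have "card (starts 4 f i) = (\<Sum>c\<in>{1, 2}. of_bool (c \<in> starts 4 f i))"
    by (simp only: sum_of_bool_eq finite.intros Int_def mem_Collect_eq Collect_mem_eq of_nat_id)
  then show ?thesis by simp
qed

lemma prism_coloring_eq_2:
  assumes "f \<in> prism_colorings n" "i < n" "v < 4"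
  shows "f (v, i) = 2 \<longleftrightarrow> f (v, i) \<noteq> 1"
  using prism_coloring_cases[OF assms] by auto

lemma card_starts_0:
  assumes "f \<in> prism_colorings n" "0 < n"
  shows "card (starts 4 f 0) = colors_in_column (column_of f 0)"
  unfolding card_starts[OF assms]
  by (simp add: starts_def column_of_def ex_less_4 prism_coloring_eq_2[OF assms] del: One_nat_def)

lemma card_starts_Suc:
  assumes "f \<in> prism_colorings n" "Suc i < n"
  shows "card (starts 4 f (Suc i)) = new_in_column (column_of f i) (column_of f (Suc i))"
proof -
  have "i < n" using assms(2) by simp
  note eq = prism_coloring_eq_2[OF assms] prism_coloring_eq_2[OF assms(1) this]
  show ?thesis
    unfolding card_starts[OF assms] column_of_def new_in_column.simps
    by (intro arg_cong2[of _ _ _ _ "(+)"] arg_cong[of _ _ of_bool])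
      (auto simp: starts_def ex_less_4 eq simp del: One_nat_def)
qed

lemma append_column_other: "i \<noteq> n \<or> 4 \<le> v \<Longrightarrow> append_column n g f (v, i) = f (v, i)"
  by (cases g) auto

lemma append_column_new: "v < 4 \<Longrightarrow> append_column n g f (v, n) \<in> {1, 2}"
  by (cases g) (auto simp: numeral_eq_Suc less_Suc_eq)

lemma column_of_append_column:
  "column_of (append_column n g f) i = (if i = n then g else column_of f i)"
  by (cases g) (auto simp: column_of_def)

lemma starts_append_column: "i < n \<Longrightarrow> starts m (append_column n g f) i = starts m f i"
  by (auto simp: starts_def append_column_other)

lemma append_column_in_prism_colorings:
  assumes "f \<in> prism_colorings n"
  shows "append_column n g f \<in> prism_colorings (Suc n)"
proof (rule PiE_I)
  fix p :: "nat \<times> nat"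
  assume p: "p \<in> {..<4} \<times> {..<Suc n}"
  show "append_column n g f p \<in> {1..2}"
  proof (cases "snd p = n")
    case True
    then show ?thesis
      using p append_column_new[of "fst p" n g f] by (cases p) auto
  next
    case False
    then show ?thesis
      using p append_column_other[of "snd p" n "fst p" g f] PiE_mem[OF assms, of p]
      by (cases p) auto
  qed
next
  fix p :: "nat \<times> nat"
  assume p: "p \<notin> {..<4} \<times> {..<Suc n}"
  then have "append_column n g f p = f p"
    using append_column_other[of "snd p" n "fst p" g f] by (cases p) auto
  then show "append_column n g f p = undefined"
    using p PiE_arb[OF assms, of p] by (cases p) auto
qed

lemma append_column_restrict:
  assumes f: "f \<in> prism_colorings (Suc n)" and g: "column_of f n = g"
  shows "append_column n g (restrict f ({..<4} \<times> {..<n})) = f"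
proof
  fix p :: "nat \<times> nat"
  obtain v i where p: "p = (v, i)" by (cases p)
  consider "v < 4" "i = n" | "v < 4" "i < n" | "(v, i) \<notin> {..<4} \<times> {..<Suc n}" by fastforce
  then show "append_column n g (restrict f ({..<4} \<times> {..<n})) p = f p"
  proof cases
    case 1
    \<comment> \<open>A column records only whether an entry is 1; with two colors this determines
      the entry.\<close>
    have "f (u, n) = (if f (u, n) = 1 then 1 else 2)" if "u < 4" for u
      using prism_coloring_cases[OF f, of n u] that by auto
    from this[of 0] this[of 1] this[of 2] this[of 3]
    have "append_column n g (restrict f ({..<4} \<times> {..<n})) (u, n) = f (u, n)"
      if "u = 0 \<or> u = 1 \<or> u = 2 \<or> u = 3" for u
      using that by (auto simp: g[symmetric] column_of_def simp del: One_nat_def)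
    moreover have "v = 0 \<or> v = 1 \<or> v = 2 \<or> v = 3" using 1 by linarith
    ultimately show ?thesis using 1 p by simp
  next
    case 2
    then show ?thesis by (simp add: p append_column_other)
  next
    case 3
    then show ?thesis
      using PiE_arb[OF f, of "(v, i)"] by (auto simp: p append_column_other)
  qed
qed

lemma bij_betw_append_column:
  "bij_betw (append_column n g) (prism_colorings n)
     {f \<in> prism_colorings (Suc n). column_of f n = g}"
proof (rule bij_betw_byWitness[where f' = "\<lambda>f. restrict f ({..<4} \<times> {..<n})"])
  show "\<forall>f\<in>prism_colorings n. restrict (append_column n g f) ({..<4} \<times> {..<n}) = f"
  proof (intro ballI ext)
    fix f p assume f: "f \<in> prism_colorings n"
    show "restrict (append_column n g f) ({..<4} \<times> {..<n}) p = f p"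
      using PiE_arb[OF f, of p] by (cases p) (auto simp: restrict_def append_column_other)
  qed
  show "\<forall>f\<in>{f \<in> prism_colorings (Suc n). column_of f n = g}.
      append_column n g (restrict f ({..<4} \<times> {..<n})) = f"
    using append_column_restrict by blast
  show "append_column n g ` prism_colorings n \<subseteq> {f \<in> prism_colorings (Suc n). column_of f n = g}"
    by (rule image_subsetI)
      (simp add: append_column_in_prism_colorings column_of_append_column del: One_nat_def)
  show "(\<lambda>f. restrict f ({..<4} \<times> {..<n})) `
      {f \<in> prism_colorings (Suc n). column_of f n = g} \<subseteq> prism_colorings n"
  proof (rule image_subsetI)
    fix f assume "f \<in> {f \<in> prism_colorings (Suc n). column_of f n = g}"
    then have "f \<in> prism_colorings (Suc n)" by blast
    then have "f p \<in> {1..2}" if "p \<in> {..<4} \<times> {..<n}" for p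
      using that by (intro PiE_mem[of f "{..<4} \<times> {..<Suc n}" "\<lambda>_. {1..2}"]) auto
    then show "restrict f ({..<4} \<times> {..<n}) \<in> prism_colorings n"
      unfolding restrict_PiE_iff by blast
  qed
qed

text \<open>The index is that of the last column, so \<open>n + 1\<close> columns are
  counted.\<close>

definition column_sum :: "nat \<Rightarrow> column \<Rightarrow> int poly" where
  "column_sum n g =
     (\<Sum>f\<in>{f \<in> prism_colorings (Suc n). column_of f n = g}. coloring_weight (Suc n) f)"

lemma column_sum_reindex:
  "column_sum n g = (\<Sum>f\<in>prism_colorings n. coloring_weight (Suc n) (append_column n g f))"
  unfolding column_sum_def by (rule sum.reindex_bij_betw[OF bij_betw_append_column, symmetric])

lemma finite_prism_colorings: "finite (prism_colorings n)"
  by (intro finite_PiE) auto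

lemma sum_by_last_column:
  "(\<Sum>f\<in>prism_colorings (Suc n). F f) =
     (\<Sum>g\<in>UNIV. \<Sum>f\<in>{f \<in> prism_colorings (Suc n). column_of f n = g}. F f)"
  by (rule sum.group[OF finite_prism_colorings, symmetric]) auto

lemma sum_coloring_weight:
  "(\<Sum>f\<in>prism_colorings (Suc n). coloring_weight (Suc n) f) = (\<Sum>g\<in>UNIV. column_sum n g)"
  unfolding column_sum_def by (rule sum_by_last_column)

lemma column_sum_0: "column_sum 0 g = monom 1 1 ^ colors_in_column g"
proof -
  have "coloring_weight 1 (append_column 0 g f) = monom 1 1 ^ colors_in_column g"
    if "f \<in> prism_colorings 0" for f
    using card_starts_0[OF append_column_in_prism_colorings[OF that], of g]
    by (simp add: coloring_weight_def column_of_append_column)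
  then show ?thesis by (simp add: column_sum_reindex)
qed

text \<open>The transfer matrix recursion: appending a column leaves the starts in earlier columns
  unchanged, so the weight gains one factor that depends only on the last two columns.\<close>

lemma column_sum_Suc:
  "column_sum (Suc n) g = (\<Sum>g'\<in>UNIV. column_sum n g' * monom 1 1 ^ new_in_column g' g)"
proof -
  have weight: "coloring_weight (Suc (Suc n)) (append_column (Suc n) g f) =
      coloring_weight (Suc n) f * monom 1 1 ^ new_in_column (column_of f n) g"
    if "f \<in> prism_colorings (Suc n)" for f
    using card_starts_Suc[OF append_column_in_prism_colorings[OF that], of n g]
    by (simp add: coloring_weight_def column_of_append_column starts_append_column power_add
        del: sum.lessThan_Suc add: sum.lessThan_Suc[of _ "Suc n"])
  have "column_sum (Suc n) g = (\<Sum>f\<in>prism_colorings (Suc n).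
      coloring_weight (Suc n) f * monom 1 1 ^ new_in_column (column_of f n) g)"
    unfolding column_sum_reindex by (rule sum.cong[OF refl weight])
  also have "\<dots> = (\<Sum>g'\<in>UNIV. column_sum n g' * monom 1 1 ^ new_in_column g' g)"
    unfolding sum_by_last_column column_sum_def sum_distrib_right by (intro sum.cong) auto
  finally show ?thesis .
qed

section \<open>Reduction to three column types\<close>

text \<open>The numbers of vertices of the two colors in a column are \<open>{0, 4}\<close>, \<open>{1, 3}\<close> or \<open>{2, 2}\<close>.\<close>

fun column_type :: "column \<Rightarrow> nat" where
  "column_type (a, b, c, d) =
     (let t = of_bool a + of_bool b + of_bool c + of_bool d in min t (4 - t))"

definition type_sum :: "nat \<Rightarrow> nat \<Rightarrow> int poly" where
  "type_sum k n = (\<Sum>g\<in>UNIV. of_bool (column_type g = k) * column_sum n g)"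

lemma sum_bool: "(\<Sum>b\<in>UNIV. F b) = F False + F True"
  by (simp add: UNIV_bool)

lemma sum_UNIV_prod:
  "(\<Sum>p\<in>UNIV. F p) = (\<Sum>a\<in>UNIV. \<Sum>b\<in>UNIV. F (a, b))"
  by (simp add: sum.cartesian_product)

lemma column_type_cases: "column_type g = 0 \<or> column_type g = 1 \<or> column_type g = 2"
  by (cases g) auto

text \<open>Used with transition weights for \<open>F\<close> to collapse the recursion, and with
  \<open>F\<close> constantly 1 to recover the full sum.\<close>

lemma sum_types: "(\<Sum>g\<in>UNIV. F (column_type g) * column_sum n g) =
    F 0 * type_sum 0 n + F 1 * type_sum 1 n + F 2 * type_sum 2 n"
  unfolding type_sum_def sum_distrib_left sum.distrib[symmetric]
proof (rule sum.cong[OF refl])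
  fix g
  show "F (column_type g) * column_sum n g =
      F 0 * (of_bool (column_type g = 0) * column_sum n g) +
      F 1 * (of_bool (column_type g = 1) * column_sum n g) +
      F 2 * (of_bool (column_type g = 2) * column_sum n g)"
    using column_type_cases[of g] by auto
qed

text \<open>The assumption says that the types can be lumped: the total weight of moving from a
  column into type \<open>k\<close> depends only on the type of that column. Exchanging the two sums
  then gives a recursion on types.\<close>

lemma type_sum_Suc:
  assumes "\<And>g'. (\<Sum>g\<in>UNIV. of_bool (column_type g = k) * monom 1 1 ^ new_in_column g' g) =
    F (column_type g')"
  shows "type_sum k (Suc n) = F 0 * type_sum 0 n + F 1 * type_sum 1 n + F 2 * type_sum 2 n"
proof -
  have "type_sum k (Suc n) = (\<Sum>g'\<in>UNIV.
      (\<Sum>g\<in>UNIV. of_bool (column_type g = k) * monom 1 1 ^ new_in_column g' g) * column_sum n g')"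
    unfolding type_sum_def column_sum_Suc sum_distrib_left sum_distrib_right
    by (subst sum.swap) (simp only: mult_ac)
  then show ?thesis unfolding assms sum_types .
qed

text \<open>Permuting rows and swapping the colors preserve \<open>new_in_column\<close> and act
  transitively on each type, which is why only the type of \<open>g'\<close> matters. The proof
  checks all 16 columns directly.\<close>

lemma column_transitions:
  fixes y :: "'a::comm_ring_1"
  shows "(\<Sum>g\<in>UNIV. of_bool (column_type g = 0) * y ^ new_in_column g' g) =
      (if column_type g' = 0 then 1 + y else 2)"
    and "(\<Sum>g\<in>UNIV. of_bool (column_type g = 1) * y ^ new_in_column g' g) =
      (if column_type g' = 0 then 8 * y else if column_type g' = 1 then 4 + 3 * y + y^2 else 4 + 4 * y)"
    and "(\<Sum>g\<in>UNIV. of_bool (column_type g = 2) * y ^ new_in_column g' g) =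
      (if column_type g' = 0 then 6 * y else if column_type g' = 1 then 3 + 3 * y else 5 + y^2)"
proof -
  obtain a b c d where g': "g' = (a, b, c, d)" by (cases g')
  show "(\<Sum>g\<in>UNIV. of_bool (column_type g = 0) * y ^ new_in_column g' g) =
      (if column_type g' = 0 then 1 + y else 2)"
    unfolding sum_UNIV_prod sum_bool g' by (cases a; cases b; cases c; cases d; simp add: power2_eq_square)
  show "(\<Sum>g\<in>UNIV. of_bool (column_type g = 1) * y ^ new_in_column g' g) =
      (if column_type g' = 0 then 8 * y else if column_type g' = 1 then 4 + 3 * y + y^2 else 4 + 4 * y)"
    unfolding sum_UNIV_prod sum_bool g' by (cases a; cases b; cases c; cases d; simp add: power2_eq_square)
  show "(\<Sum>g\<in>UNIV. of_bool (column_type g = 2) * y ^ new_in_column g' g) =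
      (if column_type g' = 0 then 6 * y else if column_type g' = 1 then 3 + 3 * y else 5 + y^2)"
    unfolding sum_UNIV_prod sum_bool g' by (cases a; cases b; cases c; cases d; simp add: power2_eq_square)
qed

lemma type_sum_0:
  "type_sum 0 0 = 2 * monom 1 1" "type_sum 1 0 = 8 * monom 1 1 ^ 2" "type_sum 2 0 = 6 * monom 1 1 ^ 2"
proof -
  show "type_sum 0 0 = 2 * monom 1 1"
    unfolding type_sum_def column_sum_0 sum_UNIV_prod sum_bool by simp
  show "type_sum 1 0 = 8 * monom 1 1 ^ 2"
    unfolding type_sum_def column_sum_0 sum_UNIV_prod sum_bool by (simp add: power2_eq_square)
  show "type_sum 2 0 = 6 * monom 1 1 ^ 2"
    unfolding type_sum_def column_sum_0 sum_UNIV_prod sum_bool by (simp add: power2_eq_square)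
qed

section \<open>The linear system and its generating functions\<close>

text \<open>Cramer's rule without division: the denominator is the determinant of the system, and
  the three equations are combined with cofactors as multipliers.\<close>

lemma transfer_system_solution:
  fixes x y A B C :: "'a::idom"
  assumes A: "A = x * (2 * y + (1 + y) * A + 2 * B + 2 * C)"
    and B: "B = x * (8 * y^2 + 8 * y * A + (4 + 3 * y + y^2) * B + (4 + 4 * y) * C)"
    and C: "C = x * (6 * y^2 + 6 * y * A + (3 + 3 * y) * B + (5 + y^2) * C)"
  shows "(A + B + C) * (1 - 2 * x * (y^2 + 2 * y + 5)
           + x^2 * (y - 1) * (y^3 + 6 * y^2 + 8 * y - 17)
           - x^3 * (y - 1)^2 * (y^3 + 6 * y^2 - 17 * y + 8)) =
         2 * x * y * (1 + 7 * y - x * (y - 1) * (7 * y^2 + y - 9)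
           + x^2 * (y - 1)^2 * (8 * y^2 - 17 * y + 8))" (is "?L = ?R")
proof -
  \<comment> \<open>The coefficient matrix is \<open>((a, b, b), (d, e, f), (g, h, k))\<close>.\<close>
  define a b d e f g h k where defs: "a = 1 - x * (1 + y)" "b = - 2 * x"
    "d = - 8 * x * y" "e = 1 - x * (4 + 3 * y + y^2)" "f = - x * (4 + 4 * y)"
    "g = - 6 * x * y" "h = - x * (3 + 3 * y)" "k = 1 - x * (5 + y^2)"
  \<comment> \<open>Each row is written so that the difference of the two sides of its hypothesis
    appears and cancels, leaving the constant term.\<close>
  have "a * A + b * B + b * C = A - x * (2 * y + (1 + y) * A + 2 * B + 2 * C) + 2 * x * y"
    "d * A + e * B + f * C = B - x * (8 * y^2 + 8 * y * A + (4 + 3 * y + y^2) * B + (4 + 4 * y) * C)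
      + 8 * x * y^2"
    "g * A + h * B + k * C = C - x * (6 * y^2 + 6 * y * A + (3 + 3 * y) * B + (5 + y^2) * C)
      + 6 * x * y^2"
    unfolding defs by algebra+
  then have eqs: "a * A + b * B + b * C = 2 * x * y" "d * A + e * B + f * C = 8 * x * y^2"
    "g * A + h * B + k * C = 6 * x * y^2"
    unfolding A[symmetric] B[symmetric] C[symmetric] by simp_all
  have "?L = (A + B + C) * ((e * k - f * h) * a - (d * k - f * g) * b + (d * h - e * g) * b)"
    unfolding defs by algebra
  \<comment> \<open>The multiplier of each equation is the sum of the cofactors of its row. For the
    second and third rows it factors, because the first row \<open>(a, b, b)\<close> has two equal
    entries.\<close>
  also have "\<dots> = ((e * k - f * h) - (d * k - f * g) + (d * h - e * g)) * (a * A + b * B + b * C) +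
      (a - b) * (k - h) * (d * A + e * B + f * C) + (a - b) * (e - f) * (g * A + h * B + k * C)"
    by algebra
  also have "\<dots> = ?R" unfolding eqs unfolding defs by algebra
  finally show ?thesis .
qed

text \<open>The shift by one compensates for \<open>type_sum k n\<close> counting
  \<open>n + 1\<close> columns.\<close>

definition type_gf :: "nat \<Rightarrow> int poly fps" where
  "type_gf k = Abs_fps (\<lambda>n. if n = 0 then 0 else type_sum k (n - 1))"

lemma type_gf_eq:
  assumes "type_sum k 0 = u"
    and "\<And>n. type_sum k (Suc n) = p * type_sum 0 n + q * type_sum 1 n + r * type_sum 2 n"
  shows "type_gf k = fps_X * (fps_const u + fps_const p * type_gf 0 + fps_const q * type_gf 1
    + fps_const r * type_gf 2)"
proof (rule fps_ext)
  fix n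
  show "fps_nth (type_gf k) n = fps_nth (fps_X * (fps_const u + fps_const p * type_gf 0 +
      fps_const q * type_gf 1 + fps_const r * type_gf 2)) n"
  proof (cases n)
    case (Suc j)
    then show ?thesis using assms by (cases j) (simp_all add: type_gf_def)
  qed (simp add: type_gf_def)
qed

lemma colored_partition_gf_types: "colored_partition_gf 2 4 = type_gf 0 + type_gf 1 + type_gf 2"
proof (rule fps_ext)
  fix n
  show "fps_nth (colored_partition_gf 2 4) n = fps_nth (type_gf 0 + type_gf 1 + type_gf 2) n"
    using sum_types[of "\<lambda>_. 1"]
    by (cases n) (simp_all add: colored_partition_gf_nth sum_coloring_weight type_gf_def del: One_nat_def)
qed

theorem theorem6p6:
  shows "colored_partition_gf 2 4 =
    (let x = gf_x; y = gf_y in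
      fps_quotient
        (2 * x * y * (1 + 7 * y - x * (y - 1) * (7 * y^2 + y - 9)
           + x^2 * (y - 1)^2 * (8 * y^2 - 17 * y + 8)))
        (1 - 2 * x * (y^2 + 2 * y + 5)
           + x^2 * (y - 1) * (y^3 + 6 * y^2 + 8 * y - 17)
           - x^3 * (y - 1)^2 * (y^3 + 6 * y^2 - 17 * y + 8)))"
proof -
  note transition = column_transitions[where y = "monom (1::int) 1"]
  \<comment> \<open>These rules split the constant series of the transition polynomials into
    expressions in \<open>gf_y\<close>.\<close>
  note const = fps_const_add[symmetric] fps_const_mult[symmetric] fps_const_power[symmetric]
    numeral_fps_const[symmetric] fps_const_1_eq_1
  have "type_gf 0 = gf_x * (2 * gf_y + (1 + gf_y) * type_gf 0 + 2 * type_gf 1 + 2 * type_gf 2)"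
    using type_gf_eq[OF type_sum_0(1) type_sum_Suc[OF transition(1)]]
    by (simp only: const if_True if_False simp_thms rel_simps)
  moreover have "type_gf 1 = gf_x * (8 * gf_y^2 + 8 * gf_y * type_gf 0 +
      (4 + 3 * gf_y + gf_y^2) * type_gf 1 + (4 + 4 * gf_y) * type_gf 2)"
    using type_gf_eq[OF type_sum_0(2) type_sum_Suc[OF transition(2)]]
    by (simp only: const if_True if_False simp_thms rel_simps)
  moreover have "type_gf 2 = gf_x * (6 * gf_y^2 + 6 * gf_y * type_gf 0 +
      (3 + 3 * gf_y) * type_gf 1 + (5 + gf_y^2) * type_gf 2)"
    using type_gf_eq[OF type_sum_0(3) type_sum_Suc[OF transition(3)]]
    by (simp only: const if_True if_False simp_thms rel_simps)
  \<comment> \<open>The denominator has constant coefficient 1, so the quotient is characterized by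
    the product identity that the linear system yields.\<close>
  ultimately show ?thesis
    unfolding Let_def colored_partition_gf_types
    by (subst fps_quotient_eq_iff) (simp, rule transfer_system_solution)
qed

end
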